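(* For $\delta>0$ and $k\le n^{1/2-\delta}$, let $\mathcal{Z}$ be the planted bipartite $k$-clique problem. Then for any integer $\ell\le k$, $\mathrm{SDA}\left(\mathcal{Z},\,2^{\ell+2}k^2/n^2,\,1/\binom{n}{k}\right)\ge n^{2\ell\delta}/4$.
   Context: For $S\subseteq[n]$ with $|S|=k$, $D_S$ is the distribution on $\{0,1\}^n$ where with probability $1-k/n$ the vector is uniform on $\{0,1\}^n$, and with probability $k/n$ the coordinates in $S$ are set to $1$ and the others are uniform and independent. The planted bipartite $k$-clique problem $\mathcal{Z}$ is the search problem with domain $X=\{0,1\}^n$, distribution class $\mathcal{D}=\{D_S:|S|=k\}$, solution set $\mathcal{F}=\{S\subseteq[n]:|S|=k\}$ and $\mathcal{Z}(D_S)=\{S\}$; $\mathcal{Z}^{-1}(f)=\{D\in\mathcal{D}:f\in\mathcal{Z}(D)\}$. For distributions $D_1,D$ over $X$ (with $D(x)=0\Rightarrow D_1(x)=0$), $\frac{D_1}{D}-1$ denotes $x\mapsto D_1(x)/D(x)-1$ on the support of $D$, $\langle f,g\rangle_D=\mathbb{E}_{x\sim D}[f(x)g(x)]$, and for a finite set $\mathcal{D}'$, $\rho(\mathcal{D}',D)=\frac{1}{|\mathcal{D}'|^2}\sum_{D_1,D_2\in\mathcal{D}'}\left|\left\langle \frac{D_1}{D}-1,\frac{D_2}{D}-1\right\rangle_D\right|$. $\mathrm{SDA}(\mathcal{Z},\bar{\gamma},\eta)$ is the largest integer $d$ such that there exist a reference distribution $D$ over $X$ and a finite $\mathcal{D}_D\subseteq\mathcal{D}$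 such that for every $f\in\mathcal{F}$ the set $\mathcal{D}_f=\mathcal{D}_D\setminus\mathcal{Z}^{-1}(f)$ has size at least $(1-\eta)|\mathcal{D}_D|$ and every $\mathcal{D}'\subseteq\mathcal{D}_f$ with $|\mathcal{D}'|\ge|\mathcal{D}_f|/d$ satisfies $\rho(\mathcal{D}',D)<\bar{\gamma}$.
   Formalization: The integer ℓ is taken to be nonnegative (for very negative ℓ the claim fails, e.g. n=3, k=1, since the correlation threshold tends to 0) and k≥1 is assumed (for k=0 the threshold is 0 and ρ<0 is impossible); SDA is taken as a supremum, infinite if every d is admissible. *)

theory Defs
  imports "HOL-Probability.Probability"
begin

record ('x, 'f) search_problem =
  domain :: "'x set"
  dists :: "'x pmf set"
  solutions :: "'f set"
  valid :: "'x pmf \<Rightarrow> 'f set"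

definition valid_inv :: "('x, 'f) search_problem \<Rightarrow> 'f \<Rightarrow> 'x pmf set" where
  "valid_inv Z f = {D \<in> dists Z. f \<in> valid Z D}"

definition rel_density :: "'x pmf \<Rightarrow> 'x pmf \<Rightarrow> 'x \<Rightarrow> real" where
  "rel_density D\<^sub>1 D x = pmf D\<^sub>1 x / pmf D x - 1"

definition inner_pmf :: "'x pmf \<Rightarrow> ('x \<Rightarrow> real) \<Rightarrow> ('x \<Rightarrow> real) \<Rightarrow> real" where
  "inner_pmf D f g = measure_pmf.expectation D (\<lambda>x. f x * g x)"

definition avg_corr :: "'x pmf set \<Rightarrow> 'x pmf \<Rightarrow> real" where
  "avg_corr A D =
     1 / real (card A) ^ 2 *
     (\<Sum>D\<^sub>1\<in>A. \<Sum>D\<^sub>2\<in>A. \<bar>inner_pmf D (rel_density D\<^sub>1 D) (rel_density D\<^sub>2 D)\<bar>)"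

text \<open>The condition \<open>set_pmf D\<^sub>1 \<subseteq> set_pmf D\<close> is the standing requirement under which
  \<open>D\<^sub>1 / D - 1\<close> is meaningful; without it, and without \<open>B \<noteq> {}\<close>, the condition would be
  trivially satisfiable.\<close>

definition SDA_cond :: "('x, 'f) search_problem \<Rightarrow> real \<Rightarrow> real \<Rightarrow> nat \<Rightarrow> bool" where
  "SDA_cond Z \<gamma> \<eta> d \<longleftrightarrow>
     (\<exists>D B. set_pmf D \<subseteq> domain Z \<and>
        finite B \<and> B \<noteq> {} \<and> B \<subseteq> dists Z \<and>
        (\<forall>D\<^sub>1\<in>B. set_pmf D\<^sub>1 \<subseteq> set_pmf D) \<and>
        (\<forall>f\<in>solutions Z.
           real (card (B - valid_inv Z f)) \<ge> (1 - \<eta>) * real (card B) \<and>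
           (\<forall>A. A \<subseteq> B - valid_inv Z f \<and>
                real (card A) \<ge> real (card (B - valid_inv Z f)) / real d \<longrightarrow>
                avg_corr A D < \<gamma>)))"

text \<open>\<open>SDA_cond\<close> is inherited by smaller positive \<open>d\<close>, so the supremum is the largest
  admissible \<open>d\<close> whenever there is one. There is none when every \<open>d\<close> is admissible (for
  instance when \<open>\<gamma>\<close> exceeds every single correlation); the value is then \<open>\<infinity>\<close>. It is \<open>0\<close> when no
  positive \<open>d\<close> is admissible.\<close>

definition SDA :: "('x, 'f) search_problem \<Rightarrow> real \<Rightarrow> real \<Rightarrow> enat" where
  "SDA Z \<gamma> \<eta> = (SUP d\<in>{d. d \<ge> 1 \<and> SDA_cond Z \<gamma> \<eta> d}. enat d)"

lemma SDA_cond_antimono: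
  assumes "SDA_cond Z \<gamma> \<eta> d" "1 \<le> d'" "d' \<le> d"
  shows "SDA_cond Z \<gamma> \<eta> d'"
proof -
  have *: "real m / real d \<le> real m / real d'" for m
    using assms(2,3) by (intro divide_left_mono) auto
  obtain D B where D: "set_pmf D \<subseteq> domain Z" "finite B" "B \<noteq> {}" "B \<subseteq> dists Z"
      "\<forall>D\<^sub>1\<in>B. set_pmf D\<^sub>1 \<subseteq> set_pmf D"
    and B: "\<forall>f\<in>solutions Z.
           real (card (B - valid_inv Z f)) \<ge> (1 - \<eta>) * real (card B) \<and>
           (\<forall>A. A \<subseteq> B - valid_inv Z f \<and>
                real (card A) \<ge> real (card (B - valid_inv Z f)) / real d \<longrightarrow>
                avg_corr A D < \<gamma>)"
    using assms(1) unfolding SDA_cond_def by (elim exE conjE) (rule that; assumption)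
  have "avg_corr A D < \<gamma>" if "f \<in> solutions Z"
    "A \<subseteq> B - valid_inv Z f \<and> real (card A) \<ge> real (card (B - valid_inv Z f)) / real d'" for f A
    using B[rule_format, OF that(1), THEN conjunct2, rule_format, of A]
      that(2) order_trans[OF *] by simp
  then show ?thesis
    unfolding SDA_cond_def
    by (intro exI[of _ D] exI[of _ B] conjI ballI allI impI D(1-4) D(5)[rule_format]
        B[rule_format, THEN conjunct1])
qed

text \<open>\<open>{0,1}\<^sup>n\<close>, with \<open>True\<close> for \<open>1\<close>, as functions fixed to \<open>False\<close> outside \<open>{1..n}\<close>.\<close>

definition cube :: "nat \<Rightarrow> (nat \<Rightarrow> bool) set" where
  "cube n = PiE_dflt {1..n} False (\<lambda>_. UNIV)"

definition planted_dist :: "nat \<Rightarrow> nat set \<Rightarrow> (nat \<Rightarrow> bool) pmf" where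
  "planted_dist n S =
     bind_pmf (bernoulli_pmf (real (card S) / real n))
       (\<lambda>b. if b
            then Pi_pmf {1..n} False (\<lambda>i. if i \<in> S then return_pmf True else bernoulli_pmf (1/2))
            else pmf_of_set (cube n))"

definition k_subsets :: "nat \<Rightarrow> nat \<Rightarrow> nat set set" where
  "k_subsets n k = {S. S \<subseteq> {1..n} \<and> card S = k}"

definition planted_biclique :: "nat \<Rightarrow> nat \<Rightarrow> (nat \<Rightarrow> bool, nat set) search_problem" where
  "planted_biclique n k =
     \<lparr>domain = cube n,
      dists = planted_dist n ` k_subsets n k,
      solutions = k_subsets n k,
      valid = (\<lambda>D. {S \<in> k_subsets n k. planted_dist n S = D})\<rparr>"

lemma pmf_planted_dist:
  assumes "S \<in> k_subsets n k"
  shows "pmf (planted_dist n S) x =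
     real k / real n *
       pmf (Pi_pmf {1..n} False (\<lambda>i. if i \<in> S then return_pmf True else bernoulli_pmf (1/2))) x +
     (1 - real k / real n) * pmf (pmf_of_set (cube n)) x"
proof -
  have "card S = k" "S \<subseteq> {1..n}"
    using assms by (auto simp: k_subsets_def)
  moreover from this have "k \<le> n"
    using card_mono[of "{1..n}" S] by simp
  ultimately show ?thesis
    by (cases "n = 0") (auto simp: planted_dist_def pmf_bind)
qed

lemma inj_on_planted_dist:
  assumes "1 \<le> k"
  shows "inj_on (planted_dist n) (k_subsets n k)"
proof (rule inj_onI, rule ccontr)
  fix S T
  assume S: "S \<in> k_subsets n k" and T: "T \<in> k_subsets n k"
    and eq: "planted_dist n S = planted_dist n T" and "S \<noteq> T"
  let ?P = "\<lambda>S. Pi_pmf {1..n} False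
    (\<lambda>i. if i \<in> S then return_pmf True else bernoulli_pmf (1/2))"
  let ?x = "\<lambda>i. i \<in> S"
  have fin: "finite S" "finite T" and sub: "S \<subseteq> {1..n}" "T \<subseteq> {1..n}"
    and card: "card S = k" "card T = k"
    using S T by (auto simp: k_subsets_def intro: finite_subset)
  have "n > 0"
    using sub(1) card(1) assms by (cases n) auto
  have "\<not> T \<subseteq> S"
    using card card_subset_eq[OF fin(1)] \<open>S \<noteq> T\<close> by metis
  then obtain j where j: "j \<in> T" "j \<notin> S" by auto
  have "pmf (?P S) ?x > 0"
    using sub(1) by (subst pmf_Pi') (auto intro!: prod_pos)
  moreover have "pmf (?P T) ?x = 0"
    using sub j by (subst pmf_Pi') (auto intro!: prod_zero bexI[of _ j])
  moreover have "pmf (?P S) ?x = pmf (?P T) ?x"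
    using arg_cong[OF eq, of "\<lambda>D. pmf D ?x"] assms \<open>n > 0\<close>
    by (simp add: pmf_planted_dist[OF S] pmf_planted_dist[OF T])
  ultimately show False by simp
qed

lemma valid_planted_biclique:
  assumes "1 \<le> k" "S \<in> k_subsets n k"
  shows "valid (planted_biclique n k) (planted_dist n S) = {S}"
  using assms(2) inj_on_planted_dist[OF assms(1), of n]
  by (auto simp: planted_biclique_def dest: inj_onD)

end

theory Submission
  imports Defs
begin

text \<open>
  With the uniform distribution on the cube as reference, the correlation of two planted
  distributions is \<open>(k/n)\<^sup>2 (2\<^bsup>|S \<inter> T|\<^esup> - 1)\<close>. The inequality
  \<open>2\<^sup>\<lambda> \<le> 2\<^sup>l (1 + \<Sum>\<^sub>j\<^sub>>\<^sub>l binom(\<lambda>, j))\<close> reduces the average correlation with \<open>D\<^sub>S\<close> to binomial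
  moments of \<open>|S \<inter> T|\<close>. Over all \<open>m = binom(n, k)\<close> sets \<open>T\<close> the \<open>j\<close>-th moment adds up to at most
  \<open>m (k\<^sup>2/n)\<^sup>j / j!\<close>, and \<open>k\<^sup>2/n \<le> r\<close> with \<open>r = n\<^bsup>-2\<delta>\<^esup> \<le> 1\<close>, so the terms with \<open>j > l\<close> contribute
  at most \<open>2 m r\<^sup>l\<close> in total. For \<open>m \<ge> 3\<close> this is at most \<open>3 |A|\<close> for every family \<open>A\<close> with
  \<open>|A| \<ge> (m - 1) r\<^sup>l\<close>. The integer \<open>d = \<lceil>n\<^bsup>2l\<delta>\<^esup>/4\<rceil>\<close> is at most \<open>r\<^bsup>-l\<^esup>\<close>, so this covers all families
  of size at least \<open>(m - 1)/d\<close>.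
\<close>

section \<open>Correlations of planted distributions\<close>

lemma finite_cube: "finite (cube n)"
  unfolding cube_def by (rule finite_PiE_dflt) auto

lemma card_cube: "card (cube n) = 2 ^ n"
  unfolding cube_def by (subst card_PiE_dflt) auto

lemma cube_nonempty: "cube n \<noteq> {}"
  using card_cube[of n] by auto

lemma card_cube_fixed_True:
  assumes "W \<subseteq> {1..n}"
  shows "card {x \<in> cube n. \<forall>i\<in>W. x i} = 2 ^ (n - card W)"
proof -
  have eq: "{x \<in> cube n. \<forall>i\<in>W. x i} = PiE_dflt {1..n} False (\<lambda>i. if i \<in> W then {True} else UNIV)"
    using assms unfolding cube_def PiE_dflt_def by (auto split: if_splits)
  have "finite W"
    using assms finite_subset by blast
  have "card {x \<in> cube n. \<forall>i\<in>W. x i} = (\<Prod>i\<in>{1..n}. if i \<in> W then 1 else 2)"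
    unfolding eq by (subst card_PiE_dflt) (auto intro!: prod.cong)
  also have "\<dots> = 2 ^ card ({1..n} - W)"
    by (subst prod.If_cases) (auto simp: Diff_eq)
  also have "card ({1..n} - W) = n - card W"
    using assms \<open>finite W\<close> by (simp add: card_Diff_subset)
  finally show ?thesis .
qed

lemma k_subsetsD:
  assumes "S \<in> k_subsets n k"
  shows "S \<subseteq> {1..n}" "finite S" "card S = k" "k \<le> n"
  using assms card_mono[of "{1..n}" S] by (auto simp: k_subsets_def intro: finite_subset)

lemma finite_k_subsets: "finite (k_subsets n k)"
  unfolding k_subsets_def by (rule finite_subset[of _ "Pow {1..n}"]) auto

lemma card_k_subsets: "card (k_subsets n k) = n choose k"
  unfolding k_subsets_def by (simp add: n_subsets)

lemma pmf_Pi_planted: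
  assumes "S \<in> k_subsets n k" "x \<in> cube n"
  shows "pmf (Pi_pmf {1..n} False (\<lambda>i. if i \<in> S then return_pmf True else bernoulli_pmf (1/2))) x
    = (if \<forall>i\<in>S. x i then (1/2) ^ (n - k) else 0)"
proof -
  note S = k_subsetsD[OF assms(1)]
  \<comment> \<open>\<open>pmf_Pi'\<close> gives the product formula only at points that take the
    default value \<open>False\<close> off \<open>{1..n}\<close>; membership in the cube ensures
    this.\<close>
  have x: "x i = False" if "i \<notin> {1..n}" for i
    using assms(2) that by (auto simp: cube_def PiE_dflt_def)
  have "pmf (Pi_pmf {1..n} False (\<lambda>i. if i \<in> S then return_pmf True else bernoulli_pmf (1/2))) x
      = (\<Prod>i\<in>{1..n}. if i \<in> S then of_bool (x i) else 1/2)"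
    using x by (subst pmf_Pi') (auto intro!: prod.cong split: split_of_bool simp: indicator_def)
  also have "\<dots> = (\<Prod>i\<in>S. of_bool (x i)) * (1/2) ^ card ({1..n} - S)"
    using S by (subst prod.If_cases) (auto simp: Diff_eq Int_absorb1)
  also have "card ({1..n} - S) = n - k"
    using S by (simp add: card_Diff_subset)
  also have "(\<Prod>i\<in>S. of_bool (x i)) = (of_bool (\<forall>i\<in>S. x i) :: real)"
    using S by (auto intro: prod_zero)
  finally show ?thesis by simp
qed

text \<open>With \<open>c = k/n\<close>, the planted law is \<open>c P + (1 - c) U\<close> for the
  uniform law \<open>U\<close>, so its relative density minus 1 is \<open>c (P/U - 1)\<close>. Here
  \<open>P/U\<close> is \<open>2^k\<close> on the points that are 1 on all of \<open>S\<close>, and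
  0 elsewhere.\<close>

lemma rel_density_planted:
  assumes "S \<in> k_subsets n k" "x \<in> cube n"
  shows "rel_density (planted_dist n S) (pmf_of_set (cube n)) x =
    real k / real n * (2 ^ k * of_bool (\<forall>i\<in>S. x i) - 1)"
proof -
  have U: "pmf (pmf_of_set (cube n)) x = 1 / 2 ^ n"
    using assms(2) finite_cube cube_nonempty by (simp add: card_cube)
  have "(1/2::real) ^ (n - k) * 2 ^ n = 2 ^ k"
    using k_subsetsD(4)[OF assms(1)] by (simp add: power_diff power_divide)
  then have P: "pmf (Pi_pmf {1..n} False
      (\<lambda>i. if i \<in> S then return_pmf True else bernoulli_pmf (1/2))) x * 2 ^ n
    = 2 ^ k * of_bool (\<forall>i\<in>S. x i)"
    unfolding pmf_Pi_planted[OF assms] by simp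
  have affine: "(c * p + (1 - c) * (1 / 2 ^ n)) / (1 / 2 ^ n) - 1 = c * (p * 2 ^ n - 1)"
    for c p :: real
    by (simp add: field_simps)
  show ?thesis
    unfolding rel_density_def pmf_planted_dist[OF assms(1)] U affine P ..
qed

text \<open>The indicators for \<open>S\<close> and \<open>T\<close> multiply to the one for
  \<open>S \<union> T\<close>, and the indicator for \<open>W\<close> has mean
  \<open>2^(-|W|)\<close>. The quadratic term thus has mean \<open>2^(2k - |S \<union> T|)\<close>,
  each linear term contributes -1 and the constant +1; finally
  \<open>2k - |S \<union> T| = |S \<inter> T|\<close>. The value is nonnegative, so the absolute
  values in \<open>avg_corr\<close> disappear.\<close>

lemma inner_planted:
  assumes S: "S \<in> k_subsets n k" and T: "T \<in> k_subsets n k"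
  shows "inner_pmf (pmf_of_set (cube n))
      (rel_density (planted_dist n S) (pmf_of_set (cube n)))
      (rel_density (planted_dist n T) (pmf_of_set (cube n)))
    = (real k / real n)\<^sup>2 * (2 ^ card (S \<inter> T) - 1)"
proof -
  note S' = k_subsetsD[OF S] and T' = k_subsetsD[OF T]
  let ?c = "real k / real n"
  have count: "(\<Sum>x\<in>cube n. of_bool (\<forall>i\<in>W. x i)) = (2::real) ^ n / 2 ^ card W"
    if "W \<subseteq> {1..n}" for W
  proof -
    have "card W \<le> n"
      using card_mono[OF _ that] by simp
    moreover have "(\<Sum>x\<in>cube n. of_bool (\<forall>i\<in>W. x i)) = real (card {x \<in> cube n. \<forall>i\<in>W. x i})"
      using finite_cube by (simp add: sum.If_cases of_bool_def Int_def)
    ultimately show ?thesis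
      unfolding card_cube_fixed_True[OF that] of_nat_power by (simp add: power_diff)
  qed
  have "inner_pmf (pmf_of_set (cube n))
      (rel_density (planted_dist n S) (pmf_of_set (cube n)))
      (rel_density (planted_dist n T) (pmf_of_set (cube n)))
    = (\<Sum>x\<in>cube n. ?c * (2 ^ k * of_bool (\<forall>i\<in>S. x i) - 1) *
        (?c * (2 ^ k * of_bool (\<forall>i\<in>T. x i) - 1))) / 2 ^ n"
    unfolding inner_pmf_def
    using finite_cube cube_nonempty
    by (subst integral_pmf_of_set)
       (auto simp: card_cube rel_density_planted[OF S] rel_density_planted[OF T]
          intro!: sum.cong arg_cong2[where f = "(/)"])
  also have "(\<Sum>x\<in>cube n. ?c * (2 ^ k * of_bool (\<forall>i\<in>S. x i) - 1) *
        (?c * (2 ^ k * of_bool (\<forall>i\<in>T. x i) - 1)))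
     = (\<Sum>x\<in>cube n. ?c\<^sup>2 * (2 ^ k * 2 ^ k * of_bool (\<forall>i\<in>S \<union> T. x i)
         - 2 ^ k * of_bool (\<forall>i\<in>S. x i) - 2 ^ k * of_bool (\<forall>i\<in>T. x i) + 1))"
    by (intro sum.cong refl) (auto simp: algebra_simps power2_eq_square)
  also have "\<dots> = ?c\<^sup>2 * (2 ^ k * 2 ^ k * (\<Sum>x\<in>cube n. of_bool (\<forall>i\<in>S \<union> T. x i))
       - 2 ^ k * (\<Sum>x\<in>cube n. of_bool (\<forall>i\<in>S. x i))
       - 2 ^ k * (\<Sum>x\<in>cube n. of_bool (\<forall>i\<in>T. x i)) + 2 ^ n)"
    by (simp add: sum.distrib sum_subtractf sum_distrib_left card_cube
          del: Un_iff flip: sum_distrib_left)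
  also have "\<dots> = ?c\<^sup>2 * (2 ^ k * 2 ^ k * (2 ^ n / 2 ^ card (S \<union> T)) - 2 ^ n)"
    using S' T' by (subst (1 2 3) count) auto
  also have "\<dots> / 2 ^ n = ?c\<^sup>2 * (2 ^ k * 2 ^ k / 2 ^ card (S \<union> T) - 1)"
    by (simp add: diff_divide_distrib right_diff_distrib)
  also have "(2::real) ^ k * 2 ^ k = 2 ^ card (S \<union> T) * 2 ^ card (S \<inter> T)"
    using card_Un_Int[of S T] S' T' by (simp flip: power_add)
  finally show ?thesis by simp
qed

lemma set_pmf_planted_subset_cube:
  assumes "S \<in> k_subsets n k"
  shows "set_pmf (planted_dist n S) \<subseteq> cube n"
proof -
  have "set_pmf (Pi_pmf {1..n} False (\<lambda>i. if i \<in> S then return_pmf True else bernoulli_pmf (1/2)))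
      \<subseteq> cube n"
    by (auto simp: set_Pi_pmf cube_def PiE_dflt_def)
  then show ?thesis
    using finite_cube cube_nonempty unfolding planted_dist_def by (auto split: if_splits)
qed

section \<open>Binomial moments of the intersection size\<close>

text \<open>Double counting of the pairs \<open>(T, U)\<close> where \<open>U\<close> is a
  \<open>j\<close>-subset of \<open>S \<inter> T\<close>: each \<open>U\<close> is completed to a
  \<open>T\<close> by \<open>k - j\<close> of the other \<open>n - j\<close> points.\<close>

lemma sum_choose_card_Int:
  assumes S: "S \<in> k_subsets n k" and "j \<le> k"
  shows "(\<Sum>T\<in>k_subsets n k. card (S \<inter> T) choose j) = (k choose j) * ((n - j) choose (k - j))"
proof -
  note S' = k_subsetsD[OF S]
  let ?J = "{U. U \<subseteq> S \<and> card U = j}"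
  have "finite ?J"
    using S' by simp
  have "(\<Sum>T\<in>k_subsets n k. card (S \<inter> T) choose j)
      = (\<Sum>T\<in>k_subsets n k. card {U \<in> ?J. U \<subseteq> T})"
  proof (intro sum.cong refl)
    fix T
    have "{U \<in> ?J. U \<subseteq> T} = {U. U \<subseteq> S \<inter> T \<and> card U = j}"
      by auto
    then show "card (S \<inter> T) choose j = card {U \<in> ?J. U \<subseteq> T}"
      using S' n_subsets[of "S \<inter> T" j] by (simp only: finite_Int simp_thms)
  qed
  also have "\<dots> = (\<Sum>U\<in>?J. card {T \<in> k_subsets n k. U \<subseteq> T})"
    using sum_multicount_gen[OF finite_k_subsets[of n k] \<open>finite ?J\<close>,
        of "\<lambda>T U. U \<subseteq> T" "\<lambda>U. card {T \<in> k_subsets n k. U \<subseteq> T}"] by simp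
  also have "\<dots> = (\<Sum>U\<in>?J. (n - j) choose (k - j))"
  proof (intro sum.cong refl)
    fix U assume "U \<in> ?J"
    then have U: "U \<subseteq> {1..n}" "finite U" "card U = j"
      using S' finite_subset by auto
    have "bij_betw (\<lambda>V. V \<union> U) {V. V \<subseteq> {1..n} - U \<and> card V = k - j} {T \<in> k_subsets n k. U \<subseteq> T}"
    proof (rule bij_betw_byWitness[where f' = "\<lambda>T. T - U"])
      show "(\<lambda>V. V \<union> U) ` {V. V \<subseteq> {1..n} - U \<and> card V = k - j} \<subseteq> {T \<in> k_subsets n k. U \<subseteq> T}"
      proof (intro image_subsetI)
        fix V assume V: "V \<in> {V. V \<subseteq> {1..n} - U \<and> card V = k - j}"
        then have "finite V" "V \<inter> U = {}"
          using finite_subset[of V "{1..n} - U"] by auto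
        then show "V \<union> U \<in> {T \<in> k_subsets n k. U \<subseteq> T}"
          using V U \<open>j \<le> k\<close> by (auto simp: k_subsets_def card_Un_disjoint)
      qed
      show "(\<lambda>T. T - U) ` {T \<in> k_subsets n k. U \<subseteq> T} \<subseteq> {V. V \<subseteq> {1..n} - U \<and> card V = k - j}"
        using U by (auto simp: k_subsets_def card_Diff_subset)
    qed auto
    then have "card {T \<in> k_subsets n k. U \<subseteq> T} = card {V. V \<subseteq> {1..n} - U \<and> card V = k - j}"
      by (rule bij_betw_same_card[symmetric])
    also have "\<dots> = (n - j) choose (k - j)"
      using U by (simp add: n_subsets card_Diff_subset)
    finally show "card {T \<in> k_subsets n k. U \<subseteq> T} = (n - j) choose (k - j)" .
  qed
  also have "\<dots> = (k choose j) * ((n - j) choose (k - j))"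
    using S' by (simp add: n_subsets)
  finally show ?thesis .
qed

text \<open>The quotient of the two binomials is the product of \<open>(k - i)/(n - i)\<close> over
  \<open>i < j\<close>, and each factor is at most \<open>k/n\<close>. The form without division
  keeps the induction in the naturals.\<close>

lemma choose_ratio_le:
  assumes "k \<le> n" "j \<le> k"
  shows "(k choose j) * n ^ j \<le> k ^ j * (n choose j)"
  using assms(2)
proof (induction j)
  case (Suc j)
  have "(k - j) * n \<le> k * (n - j)"
    using assms(1) by (auto simp: diff_mult_distrib diff_mult_distrib2 intro!: diff_le_mono2)
  then have "((k choose j) * n ^ j) * ((k - j) * n) \<le> (k ^ j * (n choose j)) * (k * (n - j))"
    using Suc by (intro mult_le_mono[OF Suc.IH]) auto
  \<comment> \<open>After scaling by \<open>Suc j\<close>, passing from \<open>j\<close> to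
    \<open>Suc j\<close> multiplies the binomial by exactly \<open>N - j\<close>. Both sides of the
    goal are compared in this scaled form.\<close>
  moreover have absorb: "Suc j * (N choose Suc j) = (N choose j) * (N - j)" for N
    using binomial_absorb_comp[of N j] binomial_absorption[of j N]
    by (simp only: mult.commute[of "N - j"])
  have "Suc j * ((k choose Suc j) * n ^ Suc j) = ((k choose j) * n ^ j) * ((k - j) * n)"
    unfolding mult.assoc[symmetric] absorb by (simp only: power_Suc mult_ac)
  moreover have "Suc j * (k ^ Suc j * (n choose Suc j)) = (k ^ j * (n choose j)) * (k * (n - j))"
    unfolding mult.left_commute[of "Suc j"] absorb by (simp only: power_Suc mult_ac)
  ultimately have "Suc j * ((k choose Suc j) * n ^ Suc j) \<le> Suc j * (k ^ Suc j * (n choose Suc j))"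
    by (simp only:)
  then show ?case
    by (simp only: Suc_mult_le_cancel1)
qed simp

text \<open>The exact moment equals \<open>(n choose k) (k choose j)\<close> times the quotient
  \<open>(k choose j) / (n choose j)\<close>. The binomial is at most \<open>k^j / j!\<close> and
  the quotient at most \<open>(k/n)^j\<close>.\<close>

lemma choose_moment_bound:
  assumes S: "S \<in> k_subsets n k" and "j \<le> k" "n > 0"
  shows "(\<Sum>T\<in>k_subsets n k. real (card (S \<inter> T) choose j))
    \<le> real (n choose k) * ((real k)\<^sup>2 / real n) ^ j / fact j"
proof -
  have kn: "k \<le> n"
    using k_subsetsD(4)[OF S] .
  have pos: "real (n choose j) > 0"
    using kn \<open>j \<le> k\<close> by simp
  have "real (n choose k) * real (k choose j) = real (n choose j) * real ((n - j) choose (k - j))"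
    using choose_mult[OF \<open>j \<le> k\<close> kn] by (simp flip: of_nat_mult)
  then have "real ((n - j) choose (k - j)) = real (n choose k) * (real (k choose j) / real (n choose j))"
    using pos by (simp add: field_simps)
  then have "(\<Sum>T\<in>k_subsets n k. real (card (S \<inter> T) choose j))
     = real (n choose k) * (real (k choose j) * (real (k choose j) / real (n choose j)))"
    using sum_choose_card_Int[OF S \<open>j \<le> k\<close>] by (simp flip: of_nat_sum)
  also have "\<dots> \<le> real (n choose k) * (real k ^ j / fact j * (real k / real n) ^ j)"
  proof (intro mult_left_mono mult_mono)
    have "real ((k choose j) * fact j) \<le> real (k ^ j)"
      using binomial_fact_pow[of k j] by (simp only: of_nat_le_iff)
    then show "real (k choose j) \<le> real k ^ j / fact j"
      by (simp add: field_simps)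
    have "real ((k choose j) * n ^ j) \<le> real (k ^ j * (n choose j))"
      using choose_ratio_le[OF kn \<open>j \<le> k\<close>] by (simp only: of_nat_le_iff)
    then show "real (k choose j) / real (n choose j) \<le> (real k / real n) ^ j"
      using pos \<open>n > 0\<close> by (simp add: field_simps power_divide)
  qed auto
  also have "\<dots> = real (n choose k) * ((real k)\<^sup>2 / real n) ^ j / fact j"
    by (simp add: power_divide power_mult_distrib power2_eq_square)
  finally show ?thesis .
qed

text \<open>For \<open>s > l\<close>, expand \<open>2^(s - l)\<close> as a row sum: the term at 0 is
  the 1, and the term at \<open>i\<close> is at most \<open>s choose (l + i)\<close>. The upper
  limit \<open>k\<close> does not depend on \<open>s\<close>, which later allows the sums over
  \<open>j\<close> and \<open>T\<close> to be swapped.\<close>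

lemma two_power_le_choose_tail:
  assumes "s \<le> k"
  shows "(2::nat) ^ s \<le> 2 ^ l * (1 + (\<Sum>j=Suc l..k. s choose j))"
proof (cases "s \<le> l")
  case True
  then have "(2::nat) ^ s \<le> 2 ^ l"
    by (intro power_increasing) auto
  then show ?thesis
    by (simp add: trans_le_add1)
next
  case False
  \<comment> \<open>Reflecting the lower index turns the claim into monotonicity in the upper index,
    with \<open>s - l - i\<close> below in both binomials.\<close>
  have choose_le: "(s - l) choose i \<le> s choose (l + i)" if "i \<le> s - l" for i
  proof -
    have "(s - l) choose i = (s - l) choose (s - l - i)"
      using that by (rule binomial_symmetric)
    also have "\<dots> \<le> s choose (s - l - i)"
      by (rule binomial_right_mono) simp
    also have "\<dots> = s choose (l + i)"
      using binomial_symmetric[of "l + i" s] that False by (simp add: algebra_simps)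
    finally show ?thesis .
  qed
  have "(2::nat) ^ (s - l) = (\<Sum>i\<le>s - l. (s - l) choose i)"
    by (rule choose_row_sum[symmetric])
  also have "\<dots> = 1 + (\<Sum>i=1..s - l. (s - l) choose i)"
    by (simp add: atMost_atLeast0 sum.atLeast_Suc_atMost)
  also have "\<dots> \<le> 1 + (\<Sum>i=1..s - l. s choose (i + l))"
    using choose_le by (intro add_left_mono sum_mono) (auto simp: add.commute)
  also have "(\<Sum>i=1..s - l. s choose (i + l)) = (\<Sum>j=Suc l..s. s choose j)"
    using sum.shift_bounds_cl_nat_ivl[of "\<lambda>j. s choose j" 1 l "s - l"] False by simp
  also have "\<dots> \<le> (\<Sum>j=Suc l..k. s choose j)"
    using assms by (intro sum_mono2) auto
  finally have "(2::nat) ^ (s - l) \<le> 1 + (\<Sum>j=Suc l..k. s choose j)"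
    by (simp del: sum.cl_ivl_Suc)
  then have "(2::nat) ^ l * 2 ^ (s - l) \<le> 2 ^ l * (1 + (\<Sum>j=Suc l..k. s choose j))"
    by (rule mult_le_mono2)
  then show ?thesis
    using False by (simp flip: power_add)
qed

lemma sum_inverse_fact_le:
  "(\<Sum>j=Suc l..k. 1 / fact j) \<le> (2::real)"
proof -
  \<comment> \<open>Comparison with a geometric series, from \<open>2^(j - 1) \<le> j!\<close>; its
    closed form makes the induction go through.\<close>
  have partial: "(\<Sum>j=1..k. 1 / fact j) \<le> 2 - 2 * (1/2::real) ^ k"
  proof (induction k)
    case (Suc k)
    have "(2::real) ^ k \<le> fact (Suc k)"
    proof (induction k)
      case (Suc k)
      have "(2::real) * 2 ^ k \<le> real (Suc (Suc k)) * fact (Suc k)"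
        using Suc by (intro mult_mono) auto
      then show ?case by simp
    qed simp
    then have "1 / fact (Suc k) \<le> (1/2::real) ^ k"
      by (simp add: power_divide frac_le del: fact_Suc)
    then show ?case
      using Suc by (simp del: fact_Suc)
  qed simp
  have "(\<Sum>j=Suc l..k. 1 / fact j) \<le> (\<Sum>j=1..k. 1 / fact j :: real)"
    by (intro sum_mono2) auto
  also have "\<dots> \<le> 2"
    using partial by (rule order_trans) simp
  finally show ?thesis .
qed

text \<open>Only the leading 1 of the tail inequality is counted over \<open>A\<close> itself. The
  moments with \<open>j > l\<close> are bounded by those over all \<open>k\<close>-subsets, so the
  error term is independent of \<open>A\<close>.\<close>

lemma sum_two_power_card_Int_le:
  assumes S: "S \<in> k_subsets n k" and A: "A \<subseteq> k_subsets n k"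
    and "n > 0" and r: "(real k)\<^sup>2 / real n \<le> r" "r \<le> 1"
  shows "(\<Sum>T\<in>A. 2 ^ card (S \<inter> T)) \<le> 2 ^ l * (real (card A) + 2 * real (n choose k) * r ^ l)"
proof -
  note S' = k_subsetsD[OF S]
  have "0 \<le> r"
    using r(1) by (rule order_trans[rotated]) simp
  have "(\<Sum>T\<in>A. (2::real) ^ card (S \<inter> T))
      \<le> (\<Sum>T\<in>A. 2 ^ l * (1 + (\<Sum>j=Suc l..k. real (card (S \<inter> T) choose j))))"
  proof (intro sum_mono)
    fix T
    have "card (S \<inter> T) \<le> k"
      using S' card_mono[of S "S \<inter> T"] by auto
    from two_power_le_choose_tail[OF this, of l]
    have "real (2 ^ card (S \<inter> T)) \<le> real (2 ^ l * (1 + (\<Sum>j=Suc l..k. card (S \<inter> T) choose j)))"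
      by (simp only: of_nat_le_iff)
    then show "(2::real) ^ card (S \<inter> T) \<le> 2 ^ l * (1 + (\<Sum>j=Suc l..k. real (card (S \<inter> T) choose j)))"
      by (simp only: of_nat_mult of_nat_power of_nat_numeral of_nat_add of_nat_1 of_nat_sum)
  qed
  also have "\<dots> = 2 ^ l * (real (card A) + (\<Sum>j=Suc l..k. \<Sum>T\<in>A. real (card (S \<inter> T) choose j)))"
    by (subst sum.swap) (simp add: sum.distrib flip: sum_distrib_left)
  also have "(\<Sum>j=Suc l..k. \<Sum>T\<in>A. real (card (S \<inter> T) choose j))
      \<le> (\<Sum>j=Suc l..k. real (n choose k) * r ^ l * (1 / fact j))"
  proof (intro sum_mono)
    fix j assume j: "j \<in> {Suc l..k}"
    have "(\<Sum>T\<in>A. real (card (S \<inter> T) choose j))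
        \<le> (\<Sum>T\<in>k_subsets n k. real (card (S \<inter> T) choose j))"
      using A finite_k_subsets by (intro sum_mono2) auto
    also have "\<dots> \<le> real (n choose k) * ((real k)\<^sup>2 / real n) ^ j / fact j"
      using j \<open>n > 0\<close> by (intro choose_moment_bound[OF S]) auto
    also have "\<dots> \<le> real (n choose k) * r ^ l / fact j"
    proof (intro divide_right_mono mult_left_mono)
      have "((real k)\<^sup>2 / real n) ^ j \<le> r ^ j"
        using r by (intro power_mono) auto
      \<comment> \<open>Since \<open>r \<le> 1\<close>, all higher powers are replaced by
        \<open>r^l\<close>, leaving only the sum of inverse factorials.\<close>
      also have "\<dots> \<le> r ^ l"
        using j r \<open>0 \<le> r\<close> by (intro power_decreasing) auto
      finally show "((real k)\<^sup>2 / real n) ^ j \<le> r ^ l" .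
    qed auto
    finally show "(\<Sum>T\<in>A. real (card (S \<inter> T) choose j)) \<le> real (n choose k) * r ^ l * (1 / fact j)"
      by simp
  qed
  also have "(\<Sum>j=Suc l..k. real (n choose k) * r ^ l * (1 / fact j))
      = real (n choose k) * r ^ l * (\<Sum>j=Suc l..k. 1 / fact j)"
    by (rule sum_distrib_left[symmetric])
  also have "\<dots> \<le> real (n choose k) * r ^ l * 2"
    using \<open>0 \<le> r\<close> sum_inverse_fact_le by (intro mult_left_mono) auto
  finally show ?thesis
    by (simp add: mult_ac)
qed

section \<open>The statistical dimension\<close>

text \<open>The average correlation is a mean of row sums, so a bound on every row suffices;
  injectivity of \<open>planted_dist\<close> moves the sums from distributions to sets.\<close>

lemma avg_corr_planted_less:
  assumes A: "A \<subseteq> k_subsets n k" and "1 \<le> k" "n > 0" "c > 0"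
    and bound: "\<And>S. S \<in> A \<Longrightarrow> (\<Sum>T\<in>A. 2 ^ card (S \<inter> T) - 1) < c * real (card A)"
  shows "avg_corr (planted_dist n ` A) (pmf_of_set (cube n)) < c * (real k)\<^sup>2 / (real n)\<^sup>2"
\<comment> \<open>The empty family does occur: it meets the size condition when
  \<open>n choose k = 1\<close>. Its average correlation is 0.\<close>
proof (cases "A = {}")
  case True
  then show ?thesis
    using assms by (simp add: avg_corr_def)
next
  case False
  have "finite A"
    using A finite_k_subsets finite_subset by blast
  then have "card A > 0"
    using False by (simp add: card_gt_0_iff)
  have inj: "inj_on (planted_dist n) A"
    using inj_on_planted_dist[OF \<open>1 \<le> k\<close>] A by (rule inj_on_subset)
  have "avg_corr (planted_dist n ` A) (pmf_of_set (cube n))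
     = 1 / (real (card A))\<^sup>2 * (\<Sum>S\<in>A. \<Sum>T\<in>A. (real k / real n)\<^sup>2 * (2 ^ card (S \<inter> T) - 1))"
    unfolding avg_corr_def card_image[OF inj] sum.reindex[OF inj] o_def
    using A by (intro arg_cong2[where f = "(*)"] sum.cong refl)
      (auto simp: inner_planted[OF subsetD subsetD] abs_mult)
  also have "\<dots> = (real k / real n)\<^sup>2 / (real (card A))\<^sup>2 * (\<Sum>S\<in>A. \<Sum>T\<in>A. 2 ^ card (S \<inter> T) - 1)"
    by (simp only: sum_distrib_left[symmetric]) simp
  also have "\<dots> < (real k / real n)\<^sup>2 / (real (card A))\<^sup>2 * (\<Sum>S\<in>A. c * real (card A))"
    using \<open>card A > 0\<close> \<open>finite A\<close> False bound \<open>1 \<le> k\<close> \<open>n > 0\<close>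
    by (intro mult_strict_left_mono sum_strict_mono) auto
  also have "\<dots> = c * (real k)\<^sup>2 / (real n)\<^sup>2"
    using \<open>card A > 0\<close> by (simp add: power2_eq_square)
  finally show ?thesis .
qed

lemma planted_sum_less:
  assumes S: "S \<in> k_subsets n k" and A: "A \<subseteq> k_subsets n k" "A \<noteq> {}"
    and "n > 0" and r: "(real k)\<^sup>2 / real n \<le> r" "r \<le> 1" "0 < r"
    and card: "(real (n choose k) - 1) * r ^ l \<le> real (card A)"
  shows "(\<Sum>T\<in>A. 2 ^ card (S \<inter> T) - 1) < (2::real) ^ (l + 2) * real (card A)"
proof -
  note S' = k_subsetsD[OF S]
  have "finite A"
    using A finite_k_subsets finite_subset by blast
  then have pos: "card A > 0"
    using A by (simp add: card_gt_0_iff)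
  show ?thesis
  \<comment> \<open>For \<open>k = 1\<close> the number of sets is \<open>n\<close>, which may be
    below 3; there each summand is at most 1, which is enough directly.\<close>
  proof (cases "k \<le> 1")
    case True
    have "(\<Sum>T\<in>A. (2::real) ^ card (S \<inter> T) - 1) \<le> (\<Sum>T\<in>A. 1)"
    proof (intro sum_mono)
      fix T
      have "card (S \<inter> T) \<le> 1"
        using S' card_mono[of S "S \<inter> T"] True by auto
      then have "(2::real) ^ card (S \<inter> T) \<le> 2 ^ 1"
        by (intro power_increasing) auto
      then show "(2::real) ^ card (S \<inter> T) - 1 \<le> 1" by simp
    qed
    also have "\<dots> < 2 ^ (l + 2) * real (card A)"
      using pos one_le_power[of "2::real" l] by (simp add: power_add del: one_le_power)
    finally show ?thesis .
  next
    case False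
    have "(real k)\<^sup>2 / real n \<le> 1"
      using r by linarith
    \<comment> \<open>From \<open>k^2 \<le> n\<close> and \<open>k \<ge> 2\<close> one gets
      \<open>n/k \<ge> 2\<close>, hence \<open>n choose k \<ge> (n/k)^k \<ge> 4\<close>.\<close>
    then have "real k \<le> real n / real k"
      using \<open>n > 0\<close> False by (simp add: field_simps power2_eq_square)
    then have "(2::real) \<le> real n / real k"
      using False by linarith
    then have "(2::real) ^ 2 \<le> (real n / real k) ^ k"
      using False S'(4) order_trans[OF power_mono[of 2 "real n / real k" 2]
          power_increasing[of 2 k "real n / real k"]] by simp
    also have "\<dots> \<le> real (n choose k)"
      using binomial_ge_n_over_k_pow_k[OF S'(4), where 'a = real] by simp
    finally have m: "real (n choose k) \<ge> 4" by simp
    \<comment> \<open>\<open>2 m \<le> 3 (m - 1)\<close> holds once \<open>m \<ge> 3\<close>.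
      Together with the main term \<open>|A|\<close> this gives \<open>4 |A|\<close>, the source of
      the exponent \<open>l + 2\<close>.\<close>
    have "2 * real (n choose k) * r ^ l \<le> 3 * ((real (n choose k) - 1) * r ^ l)"
      using m r by (simp add: mult_right_mono flip: mult.assoc)
    then have "2 * real (n choose k) * r ^ l \<le> 3 * real (card A)"
      using card by linarith
    then have "2 ^ l * (real (card A) + 2 * real (n choose k) * r ^ l)
        \<le> 2 ^ l * (4 * real (card A))"
      by (intro mult_left_mono) auto
    from order_trans[OF sum_two_power_card_Int_le[OF S A(1) \<open>n > 0\<close> r(1,2)] this]
    have "(\<Sum>T\<in>A. 2 ^ card (S \<inter> T)) \<le> (2::real) ^ (l + 2) * real (card A)"
      by (simp add: power_add mult_ac)
    \<comment> \<open>Strictness comes from the -1 in each summand, as \<open>A\<close> is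
      nonempty.\<close>
    then show ?thesis
      using pos by (simp add: sum_subtractf)
  qed
qed

text \<open>The witnesses are the uniform law on the cube and the family of all planted
  distributions. Each solution is valid for exactly one member, so \<open>m - 1\<close> of the
  \<open>m = n choose k\<close> remain, which is exactly the fraction
  \<open>1 - 1/m\<close>.\<close>

lemma SDA_cond_planted:
  assumes "1 \<le> k" "k \<le> n" and r: "(real k)\<^sup>2 / real n \<le> r" "r \<le> 1" "0 < r"
    and d: "1 \<le> d" "real d * r ^ l \<le> 1"
  shows "SDA_cond (planted_biclique n k) (2 ^ (l + 2) * (real k)\<^sup>2 / (real n)\<^sup>2)
    (1 / real (n choose k)) d"
proof -
  let ?Z = "planted_biclique n k" and ?p = "planted_dist n" and ?K = "k_subsets n k"
  let ?D = "pmf_of_set (cube n)" and ?m = "real (n choose k)"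
  have "n > 0"
    using assms by simp
  have m: "?m > 0"
    using \<open>k \<le> n\<close> by simp
  have set_D: "set_pmf ?D = cube n"
    using finite_cube cube_nonempty by simp
  note inj = inj_on_planted_dist[OF \<open>1 \<le> k\<close>, of n]
  have K_ne: "?K \<noteq> {}"
    using m card_k_subsets[of n k] by auto
  have rest: "?p ` ?K - valid_inv ?Z f = ?p ` (?K - {f})" if "f \<in> ?K" for f
    using that inj by (auto simp: valid_inv_def planted_biclique_def dest: inj_onD)
  have card_rest: "real (card (?p ` ?K - valid_inv ?Z f)) = ?m - 1" if "f \<in> ?K" for f
  proof -
    have "card (?p ` (?K - {f})) = card (?K - {f})"
      using inj by (intro card_image) (auto intro: inj_on_subset)
    then show ?thesis
      using that m finite_k_subsets by (simp add: rest card_k_subsets of_nat_diff Suc_le_eq)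
  qed
  have corr: "avg_corr A ?D < 2 ^ (l + 2) * (real k)\<^sup>2 / (real n)\<^sup>2"
    if f: "f \<in> ?K" and A: "A \<subseteq> ?p ` ?K - valid_inv ?Z f"
      "real (card (?p ` ?K - valid_inv ?Z f)) / real d \<le> real (card A)" for f A
  proof -
    from A(1) obtain A' where A': "A' \<subseteq> ?K - {f}" "A = ?p ` A'"
      unfolding rest[OF f] by (rule subset_imageE)
    have cA: "card A = card A'"
      unfolding A'(2) using inj A'(1) by (intro card_image) (auto intro: inj_on_subset)
    have "?m - 1 \<le> real d * real (card A')"
      using A(2) d(1) unfolding card_rest[OF f] cA by (simp add: field_simps)
    \<comment> \<open>The hypothesis \<open>d r^l \<le> 1\<close> converts the size threshold
      \<open>(m - 1)/d\<close> into \<open>(m - 1) r^l\<close>.\<close>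
    then have "(?m - 1) * r ^ l \<le> (real d * r ^ l) * real (card A')"
      using r(3) mult_right_mono[of "?m - 1" "real d * real (card A')" "r ^ l"] by (simp add: mult_ac)
    also have "\<dots> \<le> 1 * real (card A')"
      using d(2) by (intro mult_right_mono) auto
    finally have size: "(?m - 1) * r ^ l \<le> real (card A')" by simp
    show ?thesis
      unfolding A'(2)
    proof (rule avg_corr_planted_less)
      fix S assume "S \<in> A'"
      then show "(\<Sum>T\<in>A'. 2 ^ card (S \<inter> T) - 1) < 2 ^ (l + 2) * real (card A')"
        using A'(1) size by (intro planted_sum_less[OF _ _ _ \<open>n > 0\<close> r]) auto
    qed (use A'(1) \<open>1 \<le> k\<close> \<open>n > 0\<close> in auto)
  qed
  show ?thesis
    unfolding SDA_cond_def
  proof (intro exI[of _ ?D] exI[of _ "?p ` ?K"] conjI ballI allI impI)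
    fix f assume "f \<in> solutions ?Z"
    then have f: "f \<in> ?K"
      by (simp add: planted_biclique_def)
    show "(1 - 1 / ?m) * real (card (?p ` ?K)) \<le> real (card (?p ` ?K - valid_inv ?Z f))"
      using m by (simp add: card_rest[OF f] card_image[OF inj] card_k_subsets field_simps)
    fix A assume "A \<subseteq> ?p ` ?K - valid_inv ?Z f \<and>
      real (card (?p ` ?K - valid_inv ?Z f)) / real d \<le> real (card A)"
    then show "avg_corr A ?D < 2 ^ (l + 2) * (real k)\<^sup>2 / (real n)\<^sup>2"
      using corr[OF f] by blast
  qed (use finite_k_subsets K_ne set_D in
      \<open>auto simp: planted_biclique_def dest!: set_pmf_planted_subset_cube\<close>)
qed

theorem theorem5p3:
  fixes n k l :: nat and \<delta> :: real
  assumes "\<delta> > 0"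
    and "1 \<le> k"
    and "real k \<le> real n powr (1/2 - \<delta>)"
    and "l \<le> k"
  shows "ereal_of_enat (SDA (planted_biclique n k)
             (2 ^ (l + 2) * real k ^ 2 / real n ^ 2) (1 / real (n choose k)))
         \<ge> ereal (real n powr (2 * real l * \<delta>) / 4)"
proof -
  have "n > 0"
    using assms(2,3) by (cases n) auto
  define r where "r = real n powr (- 2 * \<delta>)"
  define x where "x = real n powr (2 * real l * \<delta>)"
  \<comment> \<open>Admissible values are integers, so the target \<open>x/4\<close> is rounded
    up.\<close>
  define d where "d = nat \<lceil>x / 4\<rceil>"
  have r: "0 < r" "r \<le> 1"
    using \<open>n > 0\<close> assms(1) by (auto simp: r_def powr_minus inverse_le_1_iff intro!: ge_one_powr_ge_zero)
  have "(real k)\<^sup>2 \<le> (real n powr (1/2 - \<delta>))\<^sup>2"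
    using assms(3) by (intro power_mono) auto
  also have "\<dots> = r * real n"
    using \<open>n > 0\<close> powr_add[of "real n" "- 2 * \<delta>" 1]
    by (simp add: r_def power2_eq_square flip: powr_add)
  finally have kr: "(real k)\<^sup>2 \<le> r * real n" .
  then have k: "(real k)\<^sup>2 / real n \<le> r"
    using \<open>n > 0\<close> by (simp add: field_simps)
  have "real k * 1 \<le> real k * real k"
    using assms(2) by (intro mult_left_mono) auto
  also have "\<dots> \<le> real n"
    using order_trans[OF kr mult_right_mono[of r 1 "real n"]] r by (simp add: power2_eq_square)
  finally have "k \<le> n" by simp
  have "x \<ge> 1"
    using \<open>n > 0\<close> assms(1) by (auto simp: x_def intro!: ge_one_powr_ge_zero)
  then have d: "1 \<le> d" "x / 4 \<le> real d"
    unfolding d_def by linarith+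
  \<comment> \<open>The factor 1/4 absorbs the rounding: if \<open>1 \<le> x \<le> 4\<close> then
    \<open>d = 1\<close>, and otherwise \<open>d \<le> x/4 + 1 \<le> x\<close>.\<close>
  have "real d \<le> x"
  proof (cases "x \<le> 4")
    case True
    then have "\<lceil>x / 4\<rceil> \<le> 1" by (simp add: ceiling_le_iff)
    then show ?thesis
      using \<open>x \<ge> 1\<close> unfolding d_def by linarith
  next
    case False
    then show ?thesis
      unfolding d_def by linarith
  qed
  have "x * r ^ l = 1"
    using \<open>n > 0\<close> by (simp add: x_def r_def powr_power flip: powr_add)
  then have "real d * r ^ l \<le> 1"
    using \<open>real d \<le> x\<close> r mult_right_mono[of "real d" x "r ^ l"] by simp
  then have "SDA_cond (planted_biclique n k) (2 ^ (l + 2) * (real k)\<^sup>2 / (real n)\<^sup>2)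
      (1 / real (n choose k)) d"
    using assms(2) \<open>k \<le> n\<close> k r d(1) by (intro SDA_cond_planted)
  then have "enat d \<le> SDA (planted_biclique n k) (2 ^ (l + 2) * (real k)\<^sup>2 / (real n)\<^sup>2)
      (1 / real (n choose k))"
    unfolding SDA_def using d(1) by (intro SUP_upper) auto
  then have "ereal_of_enat (enat d) \<le> ereal_of_enat (SDA (planted_biclique n k)
      (2 ^ (l + 2) * (real k)\<^sup>2 / (real n)\<^sup>2) (1 / real (n choose k)))"
    by (simp only: ereal_of_enat_le_iff)
  moreover have "ereal (x / 4) \<le> ereal_of_enat (enat d)"
    using d(2) by simp
  ultimately show ?thesis
    unfolding x_def by (rule order_trans[rotated])
qed

end
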